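(* Let $l\in\mathbb{N}$, let $(X,\mathcal{T}_1,\ldots,\mathcal{T}_l,R)$ be a minimal rational dynamical system (with $l+1$ rational indexed families), let $k\in\mathbb{N}$ and let $k_1<k_2$ be arbitrary real numbers. Then for every non-empty open set $U\subseteq X$ there exist $\beta\in\mathbb{Q}\setminus\mathbb{Z}$ and $\gamma\in\mathbb{Z}^\ast$ with $dom^+(\beta)=\emptyset=dom^-(\gamma)$ and $\max dom^-(\beta)<k_1<k_2<\min dom^+(\gamma)$ such that $$\bigcap_{0\leq p,q\leq k}\left(U\cap(\mathcal{T}_1^{p\beta+q\gamma})^{-1}U\cap\ldots\cap(\mathcal{T}_l^{p\beta+q\gamma})^{-1}U\right)\neq\emptyset,$$ where the intersection is over all integers $p,q$ with $0\leq p,q\leq k$.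
   Context: Notation: $\mathbb{N}=\{1,2,\ldots\}$, $\mathbb{Z}^\ast=\mathbb{Z}\setminus\{0\}$. Expansion of rationals: every rational number $q$ has a unique expression $q=\sum_{s=1}^{\infty}q_{-s}\frac{(-1)^{s}}{(s+1)!}+\sum_{r=1}^{\infty}q_{r}(-1)^{r+1}r!$ with integers $0\leq q_{-s}\leq s$ for $s\geq 1$ and $0\leq q_r\leq r$ for $r\geq 1$, all but finitely many of which are zero. Put $dom(q)=\{t\in\mathbb{Z}^\ast: q_t\neq 0\}$, $dom^-(q)=\{t\in dom(q): t<0\}$, $dom^+(q)=\{t\in dom(q): t>0\}$. Rational indexed family: given a family $\{T_n\}_{n\in\mathbb{Z}^\ast}$ of pairwise commuting continuous maps $X\to X$, for a non-zero rational $q$ with $dom(q)=\{t_1<\ldots<t_m\}$ put $\mathcal{T}^q(x)=T_{t_1}^{q_{t_1}}\cdots T_{t_m}^{q_{t_m}}(x)$, and put $\mathcal{T}^0(x)=x$. Then $\mathcal{T}=(\mathcal{T}^q)_{q\in\mathbb{Q}}$ is the rational indexed family defined from $\{T_n\}_{n\in\mathbb{Z}^\ast}$. Rational dynamical system: $(X,\mathcal{T}_1,\ldots,\mathcal{T}_s)$ where $X$ is a compact metric space and, for $1\leq i\leq s$, $\mathcal{T}_i$ is the rational indexed family defined from a family $\{T_{i,n}\}_{n\in\mathbb{Z}^\ast}$ of homeomorphisms of $X$ onto itself, such that $T_{i,n_1}T_{j,n_2}=T_{j,n_2}T_{i,n_1}$ for all $1\leq i,j\leq s$ and $n_1,n_2\in\mathbb{Z}^\ast$.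 It is minimal if every closed $Y\subseteq X$ with $T_{i,n}(Y)=Y$ for all $1\leq i\leq s$, $n\in\mathbb{Z}^\ast$ satisfies $Y=X$ or $Y=\emptyset$. In the claim this is applied with $s=l+1$ and $\mathcal{T}_{l+1}=R$. *)

theory Defs
  imports "HOL-Analysis.Analysis"
begin

text \<open>
  Digits are indexed by all of \<^typ>\<open>int\<close>. The bound \<^term>\<open>c t \<le> nat \<bar>t\<bar>\<close> forces
  \<^term>\<open>c 0 = 0\<close>, so the index 0, which has no digit in the expansion, carries no
  information. The two series are written as sums over the finite sets of their non-zero digits.
\<close>

definition is_rat_expansion :: "rat \<Rightarrow> (int \<Rightarrow> nat) \<Rightarrow> bool" where
  "is_rat_expansion q c \<longleftrightarrow>
     (\<forall>t. c t \<le> nat \<bar>t\<bar>) \<and>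
     finite {t. c t \<noteq> 0} \<and>
     q = (\<Sum>s\<in>{s::nat. s \<ge> 1 \<and> c (- int s) \<noteq> 0}. of_nat (c (- int s)) * ((-1) ^ s / fact (s + 1)))
       + (\<Sum>r\<in>{r::nat. r \<ge> 1 \<and> c (int r) \<noteq> 0}. of_nat (c (int r)) * ((-1) ^ (r + 1) * fact r))"

text \<open>Every rational has exactly one such expansion, so the description below is proper.\<close>

definition rat_digit :: "rat \<Rightarrow> int \<Rightarrow> nat" where
  "rat_digit q = (THE c. is_rat_expansion q c)"

definition rat_dom :: "rat \<Rightarrow> int set" where
  "rat_dom q = {t. t \<noteq> 0 \<and> rat_digit q t \<noteq> 0}"

definition rat_dom_neg :: "rat \<Rightarrow> int set" where
  "rat_dom_neg q = {t \<in> rat_dom q. t < 0}"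

definition rat_dom_pos :: "rat \<Rightarrow> int set" where
  "rat_dom_pos q = {t \<in> rat_dom q. t > 0}"

text \<open>
  The composition of the iterates of \<^term>\<open>T t\<close> for \<^term>\<open>t\<close> in the domain of \<^term>\<open>q\<close>,
  the least index being the outermost factor; for \<^term>\<open>q = 0\<close> it is the identity.
\<close>

definition rat_family :: "(int \<Rightarrow> 'a \<Rightarrow> 'a) \<Rightarrow> rat \<Rightarrow> 'a \<Rightarrow> 'a" where
  "rat_family T q =
     foldr (\<circ>) (map (\<lambda>t. T t ^^ rat_digit q t) (sorted_list_of_set (rat_dom q))) id"

text \<open>
  A system is given by the maps generating its \<^term>\<open>s\<close> rational indexed families: \<^term>\<open>T i n\<close>
  is the \<^term>\<open>n\<close>-th map of the \<^term>\<open>i\<close>-th family, for \<^term>\<open>i \<in> {1..s}\<close> and \<^term>\<open>n \<noteq> 0\<close>.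
  The values of \<^term>\<open>T\<close> at other indices, and of the maps outside \<^term>\<open>X\<close>, are irrelevant.
\<close>

locale rational_dynamical_system =
  fixes X :: "'a::metric_space set"
    and s :: nat
    and T :: "nat \<Rightarrow> int \<Rightarrow> 'a \<Rightarrow> 'a"
  assumes compact_space: "compact X"
    and homeo: "\<And>i n. i \<in> {1..s} \<Longrightarrow> n \<noteq> 0 \<Longrightarrow> \<exists>g. homeomorphism X X (T i n) g"
    and commute: "\<And>i j n1 n2 x. i \<in> {1..s} \<Longrightarrow> j \<in> {1..s} \<Longrightarrow> n1 \<noteq> 0 \<Longrightarrow> n2 \<noteq> 0 \<Longrightarrow> x \<in> X \<Longrightarrow>
                    T i n1 (T j n2 x) = T j n2 (T i n1 x)"

locale minimal_rational_dynamical_system = rational_dynamical_system +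
  assumes minimal: "\<And>Y. closedin (top_of_set X) Y \<Longrightarrow>
                      (\<And>i n. i \<in> {1..s} \<Longrightarrow> n \<noteq> 0 \<Longrightarrow> T i n ` Y = Y) \<Longrightarrow> Y = X \<or> Y = {}"

end

theory Submission
  imports Defs
begin

text \<open>
  If \<open>V\<close> is a finite set of large indices, the rationals \<open>\<beta> = \<Sum>s\<in>V. (-1)^s / (s+1)!\<close> and
  \<open>\<gamma> = \<Sum>r\<in>V. (-1)^(r+1) * r!\<close> have only digits 1, so forming \<open>p * \<beta> + q * \<gamma>\<close> for \<open>p, q \<le> k\<close>
  produces no carries. Hence \<open>T i\<close> at this rational is the product over \<open>n \<in> V\<close> of the maps
  \<open>(T i (-n))^p \<circ> (T i n)^q\<close>, and the claim becomes an instance of multiple IP recurrence in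
  the manner of Furstenberg and Weiss for finitely many sequences in an abelian group acting
  minimally. That is proved by induction on the number of sequences, with a colour focusing
  argument in the inductive step.
\<close>

subsection \<open>Multiple IP recurrence for minimal abelian actions\<close>

text \<open>Elements of \<open>G\<close> are bijections of the whole type, so \<open>inv\<close> is
  the group inverse and commutation is an equation between functions. Minimality and compactness
  enter through \<open>syndetic\<close>.\<close>

locale minimal_abelian_action =
  fixes X :: "'a::topological_space set" and G :: "('a \<Rightarrow> 'a) set"
  assumes id_mem: "id \<in> G"
    and comp_mem: "g \<in> G \<Longrightarrow> h \<in> G \<Longrightarrow> g \<circ> h \<in> G"
    and inv_mem: "g \<in> G \<Longrightarrow> inv g \<in> G"
    and bij: "g \<in> G \<Longrightarrow> bij g"
    and commute: "g \<in> G \<Longrightarrow> h \<in> G \<Longrightarrow> g \<circ> h = h \<circ> g"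
    and continuous: "g \<in> G \<Longrightarrow> continuous_on X g"
    and maps_to: "g \<in> G \<Longrightarrow> g ` X \<subseteq> X"
    and syndetic: "openin (top_of_set X) U \<Longrightarrow> U \<noteq> {} \<Longrightarrow>
                     \<exists>C\<subseteq>G. finite C \<and> (\<forall>x\<in>X. \<exists>g\<in>C. g x \<in> U)"
begin

lemma commute_apply: "g \<in> G \<Longrightarrow> h \<in> G \<Longrightarrow> g (h x) = h (g x)"
  using commute by (metis comp_apply)

lemma funpow_mem: "g \<in> G \<Longrightarrow> g ^^ n \<in> G"
  by (induction n) (auto simp: id_mem comp_mem simp flip: id_def)

text \<open>Commutation makes \<open>Finite_Set.fold s x V\<close> the product of the maps
  \<open>s n\<close>, \<open>n \<in> V\<close>, applied to \<open>x\<close>, whatever the order of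
  the factors.\<close>

lemma comp_fun_commute_on_family:
  assumes "\<And>n. s n \<in> G"
  shows "comp_fun_commute_on UNIV s"
  by unfold_locales (simp add: assms commute)

lemma fold_insert_family:
  assumes "\<And>n. s n \<in> G" "finite V" "n \<notin> V"
  shows "Finite_Set.fold s x (insert n V) = s n (Finite_Set.fold s x V)"
  using comp_fun_commute_on.fold_insert[OF comp_fun_commute_on_family[OF assms(1)]] assms(2,3)
  by simp

lemma fold_union_family:
  assumes "\<And>n. s n \<in> G" "finite V" "finite W" "V \<inter> W = {}"
  shows "Finite_Set.fold s x (V \<union> W) = Finite_Set.fold s (Finite_Set.fold s x V) W"
  using comp_fun_commute_on.fold_set_union_disj[OF comp_fun_commute_on_family[OF assms(1)]] assms(2-)
  by simp

lemma fold_mem: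
  assumes "\<And>n. s n \<in> G" "finite V"
  shows "(\<lambda>x. Finite_Set.fold s x V) \<in> G"
  using assms(2)
proof induction
  case empty
  then show ?case using id_mem by (simp add: id_def)
next
  case (insert n V)
  then have "(\<lambda>x. Finite_Set.fold s x (insert n V)) = s n \<circ> (\<lambda>x. Finite_Set.fold s x V)"
    by (auto simp: fold_insert_family[OF assms(1)])
  then show ?case using comp_mem assms(1) insert.IH by simp
qed

text \<open>In the inductive step \<open>t n\<close> is moved past the whole product of the maps
  \<open>s\<close>, which lies in \<open>G\<close>.\<close>

lemma fold_comp:
  assumes "\<And>n. s n \<in> G" "\<And>n. t n \<in> G" "finite V"
  shows "Finite_Set.fold (\<lambda>n. s n \<circ> t n) x V = Finite_Set.fold s (Finite_Set.fold t x V) V"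
  using assms(3)
proof induction
  case (insert n V)
  have st: "s n \<circ> t n \<in> G" for n using assms(1,2) comp_mem by blast
  show ?case
    using insert commute_apply[OF assms(2) fold_mem[OF assms(1) insert.hyps(1)]]
    by (simp add: fold_insert_family assms st del: comp_apply) simp
qed simp

lemma openin_preimage:
  assumes "g \<in> G" "openin (top_of_set X) U"
  shows "openin (top_of_set X) (X \<inter> g -` U)"
  using continuous_openin_preimage[OF continuous[OF assms(1)] _ assms(2)] maps_to[OF assms(1)]
  by blast

text \<open>
  Translating the families by the inverse of the family \<^term>\<open>m\<close> turns the latter into the
  identity; this is what lowers the number of families in the induction.
\<close>

lemma ip_recurrence_translate:
  assumes S: "\<And>a n. a \<in> insert m A \<Longrightarrow> S a n \<in> G"
    and rec: "\<And>S' :: 'b \<Rightarrow> nat \<Rightarrow> 'a \<Rightarrow> 'a. (\<And>a n. a \<in> A \<Longrightarrow> S' a n \<in> G) \<Longrightarrow>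
      \<exists>V. finite V \<and> V \<noteq> {} \<and> V \<subseteq> {N..} \<and> (\<exists>x\<in>W. \<forall>a\<in>A. Finite_Set.fold (S' a) x V \<in> W)"
    and "W \<subseteq> X"
  shows "\<exists>V. finite V \<and> V \<noteq> {} \<and> V \<subseteq> {N..} \<and>
           (\<exists>y\<in>X. \<forall>a\<in>insert m A. Finite_Set.fold (S a) y V \<in> W)"
proof -
  define S' where "S' = (\<lambda>a n. S a n \<circ> inv (S m n))"
  have S': "S' a n \<in> G" if "a \<in> A" for a n
    unfolding S'_def by (intro comp_mem inv_mem S) (use that in auto)
  from rec[of S', OF S'] obtain V x where V: "finite V" "V \<noteq> {}" "V \<subseteq> {N..}"
    and x: "x \<in> W" "\<And>a. a \<in> A \<Longrightarrow> Finite_Set.fold (S' a) x V \<in> W" by blast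
  define P where "P = (\<lambda>x. Finite_Set.fold (S m) x V)"
  have P: "P \<in> G" unfolding P_def using S V(1) by (intro fold_mem) auto
  \<comment> \<open>Pulling back by \<open>P\<close> makes the family \<open>m\<close> send
    \<open>y\<close> to the recurrent point \<open>x\<close>.\<close>
  define y where "y = inv P x"
  have Py: "Finite_Set.fold (S m) y V = x"
    using surj_f_inv_f[OF bij_is_surj[OF bij[OF P]], of x] by (simp only: y_def P_def)
  have "Finite_Set.fold (S a) y V \<in> W" if "a \<in> A" for a
  proof -
    have "S a = (\<lambda>n. S' a n \<circ> S m n)"
      using bij[OF S[of m]] by (auto simp: S'_def fun_eq_iff bij_is_inj)
    then have "Finite_Set.fold (S a) y V = Finite_Set.fold (S' a) (Finite_Set.fold (S m) y V) V"
      using fold_comp[of "S' a" "S m" V y] S' S V(1) that by simp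
    then show ?thesis using x(2)[OF that] Py by simp
  qed
  moreover have "y \<in> X"
    using maps_to[OF inv_mem[OF P]] x(1) assms(3) by (auto simp: y_def)
  ultimately show ?thesis using V x(1) Py by blast
qed

text \<open>
  Colour focusing: a colour is an element of a finite set \<^term>\<open>C\<close> of translations whose
  preimages of \<^term>\<open>U\<close> cover \<^term>\<open>X\<close>. As long as recurrence fails, ever more distinct colours
  can be focused at one nonempty open set \<^term>\<open>W\<close>.
\<close>

lemma ip_recurrence_focus:
  assumes A: "finite A" and S: "\<And>a n. a \<in> A \<Longrightarrow> S a n \<in> G"
    and rec: "\<And>W N. openin (top_of_set X) W \<Longrightarrow> W \<noteq> {} \<Longrightarrow>
      \<exists>V. finite V \<and> V \<noteq> {} \<and> V \<subseteq> {N..} \<and> (\<exists>y\<in>X. \<forall>a\<in>A. Finite_Set.fold (S a) y V \<in> W)"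
    and U: "openin (top_of_set X) U" "U \<noteq> {}"
  shows "\<exists>V::nat set. finite V \<and> V \<noteq> {} \<and> V \<subseteq> {N..} \<and> (\<exists>x\<in>U. \<forall>a\<in>A. Finite_Set.fold (S a) x V \<in> U)"
proof (rule ccontr)
  assume no_rec: "\<not> ?thesis"
  from syndetic[OF U] obtain C where C: "C \<subseteq> G" "finite C" "\<And>x. x \<in> X \<Longrightarrow> \<exists>g\<in>C. g x \<in> U"
    by blast
  \<comment> \<open>Invariant: each of the \<open>s\<close> colours \<open>g \<in> D\<close> has a
    block below \<open>M\<close> whose products, followed by \<open>g\<close>, send all of
    \<open>W\<close> into \<open>U\<close>.\<close>
  have "\<exists>D\<subseteq>C. card D = s \<and> (\<exists>W M. openin (top_of_set X) W \<and> W \<noteq> {} \<and>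
          (\<forall>g\<in>D. \<exists>V. finite V \<and> V \<noteq> {} \<and> V \<subseteq> {N..<M} \<and>
             (\<forall>x\<in>W. \<forall>a\<in>A. g (Finite_Set.fold (S a) x V) \<in> U)))" for s
  proof (induction s)
    case 0
    show ?case using U by (intro exI[of _ "{}"]) auto
  next
    case (Suc s)
    then obtain D W M where D: "D \<subseteq> C" "card D = s" and W: "openin (top_of_set X) W" "W \<noteq> {}"
      and foc: "\<And>g. g \<in> D \<Longrightarrow> \<exists>V. finite V \<and> V \<noteq> {} \<and> V \<subseteq> {N..<M} \<and>
                (\<forall>x\<in>W. \<forall>a\<in>A. g (Finite_Set.fold (S a) x V) \<in> U)"
      by blast
    from W obtain w where w: "w \<in> W" "w \<in> X" using openin_imp_subset by blast
    with C(3) obtain h where h: "h \<in> C" "h w \<in> U" by blast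
    then have hG: "h \<in> G" using C(1) by blast
    \<comment> \<open>A repeated colour would give recurrence: \<open>h\<close> commutes with the
      products, so the point \<open>h w\<close> of \<open>U\<close> returns to \<open>U\<close>
      under all families over one block.\<close>
    have "h \<notin> D"
    proof
      assume "h \<in> D"
      from foc[OF this] obtain V where V: "finite V" "V \<noteq> {}" "V \<subseteq> {N..<M}"
        and "\<forall>a\<in>A. h (Finite_Set.fold (S a) w V) \<in> U" using w(1) by blast
      then have "\<forall>a\<in>A. Finite_Set.fold (S a) (h w) V \<in> U"
        using commute_apply[OF hG fold_mem[OF S V(1)]] by simp
      moreover have "V \<subseteq> {N..}" using V(3) by auto
      ultimately show False using no_rec V h(2) by blast
    qed
    define W' where "W' = W \<inter> (X \<inter> h -` U)"
    have W': "openin (top_of_set X) W'" "W' \<noteq> {}"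
      using openin_preimage[OF hG U(1)] W(1) h(2) w by (auto simp: W'_def)
    \<comment> \<open>Starting at \<open>M\<close> or later keeps the new block disjoint from all
      earlier ones.\<close>
    from rec[OF this, of "max N M"] obtain V y where V: "finite V" "V \<noteq> {}" "V \<subseteq> {max N M..}"
      and y: "y \<in> X" "\<And>a. a \<in> A \<Longrightarrow> Finite_Set.fold (S a) y V \<in> W'" by blast
    \<comment> \<open>The next focus: the points that all products over \<open>V\<close> send into
      \<open>W'\<close>.\<close>
    define W'' where "W'' = X \<inter> (\<Inter>a\<in>A. X \<inter> (\<lambda>x. Finite_Set.fold (S a) x V) -` W')"
    have "openin (top_of_set X) W''"
    proof (cases "A = {}")
      case False
      then have "openin (top_of_set X) (\<Inter>a\<in>A. X \<inter> (\<lambda>x. Finite_Set.fold (S a) x V) -` W')"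
        using openin_preimage[OF fold_mem[OF S V(1)] W'(1)] A by (intro openin_INT2) auto
      then show ?thesis unfolding W''_def by (intro openin_Int) auto
    qed (simp add: W''_def)
    moreover have "W'' \<noteq> {}" using y by (auto simp: W''_def)
    moreover have fold_W'': "Finite_Set.fold (S a) x V \<in> W'" if "x \<in> W''" "a \<in> A" for x a
      using that unfolding W''_def by blast
    define M' where "M' = Suc (Max (insert M V))"
    have M': "V \<subseteq> {N..<M'}" "M \<le> M'"
      using V(1,3) by (auto simp: M'_def less_Suc_eq_le intro!: Max_ge le_SucI)
    have "\<exists>V. finite V \<and> V \<noteq> {} \<and> V \<subseteq> {N..<M'} \<and>
             (\<forall>x\<in>W''. \<forall>a\<in>A. g (Finite_Set.fold (S a) x V) \<in> U)" if "g \<in> insert h D" for g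
    proof (cases "g = h")
      case True
      then show ?thesis using V M'(1) fold_W'' by (intro exI[of _ V]) (auto simp: W'_def)
    next
      case False
      with that have "g \<in> D" by blast
      from foc[OF this] obtain Vg where Vg: "finite Vg" "Vg \<noteq> {}" "Vg \<subseteq> {N..<M}"
        and g: "\<And>x a. x \<in> W \<Longrightarrow> a \<in> A \<Longrightarrow> g (Finite_Set.fold (S a) x Vg) \<in> U" by blast
      \<comment> \<open>An old colour has its block extended by \<open>V\<close>: the product over
        \<open>V\<close> leads into \<open>W\<close>, where the old block \<open>Vg\<close> takes
        over.\<close>
      have "V \<inter> Vg = {}" using V(3) Vg(3) by fastforce
      then have "g (Finite_Set.fold (S a) x (V \<union> Vg)) \<in> U" if "x \<in> W''" "a \<in> A" for x a
        using fold_W''[OF that] g[of _ a] that by (auto simp: W'_def fold_union_family S V(1) Vg(1))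
      moreover have "V \<union> Vg \<subseteq> {N..<M'}" using M' Vg(3) by fastforce
      ultimately show ?thesis using V Vg by (intro exI[of _ "V \<union> Vg"]) auto
    qed
    moreover have "card (insert h D) = Suc s" "insert h D \<subseteq> C"
      using D \<open>h \<notin> D\<close> h(1) finite_subset[OF D(1) C(2)] by auto
    ultimately show ?case by blast
  qed
  \<comment> \<open>Distinct colours from \<open>C\<close> cannot outnumber
    \<open>C\<close>.\<close>
  from this[of "Suc (card C)"] show False
    using card_mono[OF C(2)] by (metis Suc_n_not_le_n)
qed

text \<open>Induction on the index set. Recurrence for \<open>A\<close>, applied to translated
  families, yields for \<open>insert m A\<close> a point of \<open>X\<close> sent into any
  prescribed open set; focusing then provides a starting point inside \<open>U\<close>.\<close>

theorem ip_recurrence: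
  assumes "finite A" "\<And>a n. a \<in> A \<Longrightarrow> S a n \<in> G"
    and "openin (top_of_set X) U" "U \<noteq> {}"
  shows "\<exists>V::nat set. finite V \<and> V \<noteq> {} \<and> V \<subseteq> {N..} \<and>
           (\<exists>x\<in>U. \<forall>a\<in>A. Finite_Set.fold (S a) x V \<in> U)"
  using assms
proof (induction A arbitrary: S U N)
  case empty
  then show ?case by (intro exI[of _ "{N}"]) auto
next
  case (insert m A)
  show ?case
  proof (rule ip_recurrence_focus)
    fix W N assume "openin (top_of_set X) W" "W \<noteq> {}"
    then show "\<exists>V. finite V \<and> V \<noteq> {} \<and> V \<subseteq> {N..} \<and>
                 (\<exists>y\<in>X. \<forall>a\<in>insert m A. Finite_Set.fold (S a) y V \<in> W)"
      using insert.IH openin_imp_subset[of euclidean X W]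
      by (intro ip_recurrence_translate insert.prems(1)) auto
  qed (use insert in auto)
qed

end

subsection \<open>Uniqueness of digits\<close>

text \<open>Multiply by \<open>fact m\<close> for the largest \<open>m\<close> with
  \<open>d m \<noteq> 0\<close>. All other terms become integers, so \<open>d m / (m + 1)\<close> is
  an integer too, which \<open>\<bar>d m\<bar> \<le> m\<close> excludes. Later \<open>d\<close> is a
  difference of digits.\<close>

lemma neg_part_Ints_imp_zero:
  fixes d :: "nat \<Rightarrow> int"
  assumes fin: "finite A" and bound: "\<And>s. \<bar>d s\<bar> \<le> int s"
    and int: "(\<Sum>s\<in>A. of_int (d s) * ((-1) ^ s / fact (s + 1))) \<in> (\<int> :: rat set)"
    and "s \<in> A"
  shows "d s = 0"
proof (rule ccontr)
  assume "d s \<noteq> 0"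
  define B where "B = {s \<in> A. d s \<noteq> 0}"
  have B: "finite B" "B \<noteq> {}" using fin \<open>d s \<noteq> 0\<close> \<open>s \<in> A\<close> by (auto simp: B_def)
  define m where "m = Max B"
  have m: "m \<in> B" "\<And>s. s \<in> B \<Longrightarrow> s \<le> m" using B by (auto simp: m_def)
  define f where "f = (\<lambda>s. of_int (d s) * ((-1) ^ s / fact (s + 1)) :: rat)"
  have "fact m * f s \<in> \<int>" if "s \<in> B - {m}" for s
  proof -
    have "fact (s + 1) dvd (fact m :: int)"
      using that m(2)[of s] by (intro fact_dvd) auto
    then obtain c :: int where c: "fact m = fact (s + 1) * c" by blast
    have "(fact m :: rat) = of_int (fact m)" by simp
    also have "\<dots> = fact (s + 1) * of_int c" unfolding c by (metis of_int_mult of_int_fact)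
    finally have "fact m * f s = of_int (c * d s * (-1) ^ s)"
      unfolding f_def by (simp del: fact_Suc add: field_simps)
    then show ?thesis by (metis Ints_of_int)
  qed
  then have rest: "(\<Sum>s\<in>B - {m}. fact m * f s) \<in> \<int>" by (rule Ints_sum)
  have "(\<Sum>s\<in>A. f s) = (\<Sum>s\<in>B. f s)"
    using fin by (intro sum.mono_neutral_right) (auto simp: B_def f_def)
  also have "\<dots> = f m + (\<Sum>s\<in>B - {m}. f s)" using B(1) m(1) by (rule sum.remove)
  finally have "fact m * f m = fact m * (\<Sum>s\<in>A. f s) - (\<Sum>s\<in>B - {m}. fact m * f s)"
    by (simp add: algebra_simps sum_distrib_left)
  also have "\<dots> \<in> \<int>" using rest int by (intro Ints_diff Ints_mult fact_in_Ints) (simp_all only: f_def)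
  finally have "fact m * f m \<in> \<int>" .
  moreover have "(-1) ^ m * (fact m * f m) = of_int (d m) / of_nat (m + 1)"
    by (simp add: f_def flip: power_mult_distrib)
  ultimately have "of_int (d m) / of_nat (m + 1) \<in> (\<int> :: rat set)"
    by (metis Ints_1 Ints_minus Ints_mult Ints_power)
  then obtain z where "of_int (d m) / of_nat (m + 1) = (of_int z :: rat)" by (elim Ints_cases)
  then have "(of_int (d m) :: rat) = of_int (z * int (m + 1))" by (simp add: field_simps)
  then have "int (m + 1) dvd d m" by (metis of_int_eq_iff dvd_triv_right)
  then have "int (m + 1) \<le> \<bar>d m\<bar>"
    using m(1) dvd_imp_le_int[of "d m" "int (m + 1)"] by (auto simp: B_def)
  then show False using bound[of m] by simp
qed

text \<open>The dual argument, at the least \<open>m\<close> with \<open>d m \<noteq> 0\<close>: all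
  later terms are divisible by \<open>fact (m + 1)\<close>, so \<open>m + 1\<close> divides
  \<open>d m\<close>, against the bound.\<close>

lemma pos_part_zero_imp_zero:
  fixes d :: "nat \<Rightarrow> int"
  assumes fin: "finite A" and bound: "\<And>r. \<bar>d r\<bar> \<le> int r"
    and zero: "(\<Sum>r\<in>A. d r * ((-1) ^ (r + 1) * fact r)) = 0"
    and "r \<in> A"
  shows "d r = 0"
proof (rule ccontr)
  assume "d r \<noteq> 0"
  define B where "B = {r \<in> A. d r \<noteq> 0}"
  have B: "finite B" "B \<noteq> {}" using fin \<open>d r \<noteq> 0\<close> \<open>r \<in> A\<close> by (auto simp: B_def)
  define m where "m = Min B"
  have m: "m \<in> B" "\<And>r. r \<in> B \<Longrightarrow> m \<le> r" using B by (auto simp: m_def)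
  define f where "f = (\<lambda>r. d r * ((-1) ^ (r + 1) * fact r))"
  have "fact (m + 1) dvd f r" if "r \<in> B - {m}" for r
    using that m(2)[of r] unfolding f_def by (intro dvd_mult fact_dvd) auto
  then have rest: "fact (m + 1) dvd (\<Sum>r\<in>B - {m}. f r)" by (rule dvd_sum)
  have "(\<Sum>r\<in>A. f r) = (\<Sum>r\<in>B. f r)"
    using fin by (intro sum.mono_neutral_right) (auto simp: B_def f_def)
  also have "\<dots> = f m + (\<Sum>r\<in>B - {m}. f r)" using B(1) m(1) by (rule sum.remove)
  finally have "f m = - (\<Sum>r\<in>B - {m}. f r)" using zero by (simp add: f_def)
  then have "fact (m + 1) dvd f m" using rest by simp
  then have "int (m + 1) * fact m dvd (-1) ^ (m + 1) * d m * fact m"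
    by (simp add: f_def mult_ac)
  then have "int (m + 1) dvd (-1) ^ (m + 1) * d m" by (subst (asm) dvd_mult_cancel_right) simp
  then have "int (m + 1) dvd d m" by (simp add: minus_one_power_iff split: if_splits)
  then have "int (m + 1) \<le> \<bar>d m\<bar>"
    using m(1) dvd_imp_le_int[of "d m" "int (m + 1)"] by (auto simp: B_def)
  then show False using bound[of m] by simp
qed

text \<open>Both sums run over one finite set \<open>A\<close>, so that two expansions with
  different supports can be subtracted term by term. \<open>0 \<in> A\<close> is harmless because
  \<open>c 0 = 0\<close>.\<close>

lemma is_rat_expansion_iff:
  assumes "\<And>t. c t \<le> nat \<bar>t\<bar>" and A: "finite A" "\<And>t. c t \<noteq> 0 \<Longrightarrow> nat \<bar>t\<bar> \<in> A"
  shows "is_rat_expansion q c \<longleftrightarrow>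
    q = (\<Sum>s\<in>A. of_nat (c (- int s)) * ((-1) ^ s / fact (s + 1)))
      + (\<Sum>r\<in>A. of_nat (c (int r)) * ((-1) ^ (r + 1) * fact r))"
proof -
  have c0: "c 0 = 0" using assms(1)[of 0] by simp
  have "{t. c t \<noteq> 0} \<subseteq> int ` A \<union> (\<lambda>s. - int s) ` A"
  proof
    fix t assume "t \<in> {t. c t \<noteq> 0}"
    then have "nat \<bar>t\<bar> \<in> A" using A(2) by simp
    moreover have "t = int (nat \<bar>t\<bar>) \<or> t = - int (nat \<bar>t\<bar>)" by linarith
    ultimately show "t \<in> int ` A \<union> (\<lambda>s. - int s) ` A" by blast
  qed
  then have "finite {t. c t \<noteq> 0}" using A(1) finite_subset by blast
  moreover have "(\<Sum>s\<in>{s. s \<ge> 1 \<and> c (- int s) \<noteq> 0}. f s) = (\<Sum>s\<in>A. f s)"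
    if "\<And>s. c (- int s) = 0 \<Longrightarrow> f s = 0" for f :: "nat \<Rightarrow> rat"
    using A(1) A(2)[of "- int s" for s] that c0
    by (intro sum.mono_neutral_left) (fastforce simp: Suc_le_eq intro: gr0I)+
  moreover have "(\<Sum>r\<in>{r. r \<ge> 1 \<and> c (int r) \<noteq> 0}. f r) = (\<Sum>r\<in>A. f r)"
    if "\<And>r. c (int r) = 0 \<Longrightarrow> f r = 0" for f :: "nat \<Rightarrow> rat"
    using A(1) A(2)[of "int r" for r] that c0
    by (intro sum.mono_neutral_left) (fastforce simp: Suc_le_eq intro: gr0I)+
  ultimately show ?thesis using assms(1) unfolding is_rat_expansion_def by simp
qed

text \<open>The digit differences expand 0. Their negative part equals the integer
  \<open>- P\<close>, so the negative digits agree; then \<open>P = 0\<close>, and the positive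
  digits agree as well.\<close>

lemma is_rat_expansion_unique:
  assumes c: "is_rat_expansion q c" and c': "is_rat_expansion q c'"
  shows "c = c'"
proof -
  define A where "A = (\<lambda>t. nat \<bar>t\<bar>) ` ({t. c t \<noteq> 0} \<union> {t. c' t \<noteq> 0})"
  have bnd: "c t \<le> nat \<bar>t\<bar>" "c' t \<le> nat \<bar>t\<bar>" for t
    using c c' by (auto simp: is_rat_expansion_def)
  have A: "finite A" "\<And>t. c t \<noteq> 0 \<Longrightarrow> nat \<bar>t\<bar> \<in> A" "\<And>t. c' t \<noteq> 0 \<Longrightarrow> nat \<bar>t\<bar> \<in> A"
    using c c' by (auto simp: is_rat_expansion_def A_def)
  define d where "d t = int (c t) - int (c' t)" for t
  have d: "\<bar>d t\<bar> \<le> \<bar>t\<bar>" for t using bnd[of t] by (auto simp: d_def)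
  define P where "P = (\<Sum>r\<in>A. d (int r) * ((-1) ^ (r + 1) * fact r))"
  have "(\<Sum>s\<in>A. of_int (d (- int s)) * ((-1) ^ s / fact (s + 1))) + of_int P = (0 :: rat)"
    using c c' is_rat_expansion_iff[OF bnd(1) A(1,2)] is_rat_expansion_iff[OF bnd(2) A(1,3)]
    by (simp add: P_def d_def left_diff_distrib diff_divide_distrib sum_subtractf
        del: fact_Suc power_Suc)
  then have neg: "(\<Sum>s\<in>A. of_int (d (- int s)) * ((-1) ^ s / fact (s + 1))) = (of_int (- P) :: rat)"
    by linarith
  have n0: "d (- int s) = 0" if "s \<in> A" for s
    using neg_part_Ints_imp_zero[OF A(1), of "\<lambda>s. d (- int s)" s] d[of "- int s" for s] neg that
    by (metis Ints_of_int abs_minus_cancel abs_of_nat)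
  then have "P = 0" using neg by simp
  then have p0: "d (int r) = 0" if "r \<in> A" for r
    using pos_part_zero_imp_zero[OF A(1), of "\<lambda>r. d (int r)" r] d[of "int r" for r] that
    by (simp add: P_def)
  show ?thesis
  proof
    fix t
    have "t = int (nat \<bar>t\<bar>) \<or> t = - int (nat \<bar>t\<bar>)" by linarith
    then have "d t = 0" if "nat \<bar>t\<bar> \<in> A" using n0[OF that] p0[OF that] by auto
    then show "c t = c' t" using A(2,3)[of t] by (force simp: d_def)
  qed
qed

lemma rat_digit_eqI: "is_rat_expansion q c \<Longrightarrow> rat_digit q = c"
  unfolding rat_digit_def using is_rat_expansion_unique by blast

section \<open>Rationals with constant digits on a block\<close>

definition neg_block :: "nat set \<Rightarrow> rat" where
  "neg_block V = (\<Sum>s\<in>V. (-1) ^ s / fact (s + 1))"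

definition pos_block :: "nat set \<Rightarrow> rat" where
  "pos_block V = (\<Sum>r\<in>V. (-1) ^ (r + 1) * fact r)"

text \<open>No carries: \<open>p\<close> and \<open>q\<close> are at most every
  \<open>n \<in> V\<close>, hence admissible digits at \<open>- n\<close> and \<open>n\<close>, and
  the sum is already an expansion.\<close>

lemma rat_digit_blocks:
  assumes V: "finite V" "0 \<notin> V" "\<And>n. n \<in> V \<Longrightarrow> p \<le> n" "\<And>n. n \<in> V \<Longrightarrow> q \<le> n"
  shows "rat_digit (of_nat p * neg_block V + of_nat q * pos_block V) =
           (\<lambda>t. if nat \<bar>t\<bar> \<in> V then if t < 0 then p else q else 0)"
proof (rule rat_digit_eqI, subst is_rat_expansion_iff[where A = V])
  have "0 < s" if "s \<in> V" for s using V(2) that by (cases s) auto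
  then show "of_nat p * neg_block V + of_nat q * pos_block V =
    (\<Sum>s\<in>V. of_nat (if nat \<bar>- int s\<bar> \<in> V then if - int s < 0 then p else q else 0) *
        ((-1) ^ s / fact (s + 1))) +
    (\<Sum>r\<in>V. of_nat (if nat \<bar>int r\<bar> \<in> V then if int r < 0 then p else q else 0) *
        ((-1) ^ (r + 1) * fact r))"
    unfolding neg_block_def pos_block_def sum_distrib_left
    by (intro arg_cong2[where f = "(+)"] sum.cong) auto
qed (use V in \<open>auto split: if_splits\<close>)

text \<open>If the sum were an integer, its coefficients 1 would have to vanish.\<close>

lemma neg_block_notin_Ints:
  assumes "finite V" "V \<noteq> {}" "0 \<notin> V"
  shows "neg_block V \<notin> \<int>"
proof
  assume "neg_block V \<in> \<int>"
  moreover obtain v where "v \<in> V" using assms(2) by blast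
  moreover have "\<bar>if s \<in> V then 1 else 0\<bar> \<le> int s" for s using assms(3) by (cases s) auto
  ultimately show False
    using neg_part_Ints_imp_zero[OF assms(1), of "\<lambda>s. if s \<in> V then 1 else 0" v]
    by (simp add: neg_block_def del: fact_Suc)
qed

lemma pos_block_in_Ints: "pos_block V \<in> \<int>"
  unfolding pos_block_def by (intro Ints_sum Ints_mult Ints_power fact_in_Ints Ints_minus Ints_1)

lemma
  assumes V: "finite V" "0 \<notin> V"
  shows rat_dom_neg_block: "rat_dom (neg_block V) = (\<lambda>s. - int s) ` V"
    and rat_dom_pos_block: "rat_dom (pos_block V) = int ` V"
proof -
  have V1: "1 \<le> n" if "n \<in> V" for n using V(2) that by (cases n) auto
  show "rat_dom (neg_block V) = (\<lambda>s. - int s) ` V"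
    using rat_digit_blocks[OF V, of 1 0] V1
    by (force simp: rat_dom_def split: if_splits)
  show "rat_dom (pos_block V) = int ` V"
    using rat_digit_blocks[OF V, of 0 1] V1
    by (force simp: rat_dom_def split: if_splits)
qed

text \<open>Serves to pass from \<open>T i\<close> to its extension, which agrees with it only on
  \<open>X\<close>. Staying in \<open>X\<close> is carried through the inductions, so that agreement
  survives iteration and composition.\<close>

lemma rat_family_cong:
  assumes "\<And>t x. t \<noteq> 0 \<Longrightarrow> x \<in> X \<Longrightarrow> F t x = F' t x \<and> F' t x \<in> X" and "x \<in> X"
  shows "rat_family F q x = rat_family F' q x"
proof -
  have pow: "(F t ^^ n) y = (F' t ^^ n) y \<and> (F' t ^^ n) y \<in> X" if "t \<noteq> 0" "y \<in> X" for t n y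
    using that assms(1) by (induction n) auto
  have "foldr (\<circ>) (map (\<lambda>t. F t ^^ rat_digit q t) ts) id x =
        foldr (\<circ>) (map (\<lambda>t. F' t ^^ rat_digit q t) ts) id x \<and>
        foldr (\<circ>) (map (\<lambda>t. F' t ^^ rat_digit q t) ts) id x \<in> X" if "0 \<notin> set ts" for ts
    using that assms(2) pow by (induction ts) auto
  moreover have "0 \<notin> set (sorted_list_of_set (rat_dom q))"
    by (cases "finite (rat_dom q)") (auto simp: rat_dom_def)
  ultimately show ?thesis unfolding rat_family_def by blast
qed

subsection \<open>Rational families as products over blocks\<close>

context minimal_abelian_action
begin

text \<open>Factors equal to \<open>id\<close> may be added, so the domain of a rational can be
  enlarged by indices with digit 0.\<close>

lemma fold_superset:
  assumes "\<And>t. s t \<in> G" "finite D" "B \<subseteq> D" "\<And>t. t \<in> D - B \<Longrightarrow> s t = id"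
  shows "Finite_Set.fold s x D = Finite_Set.fold s x B"
proof -
  have "Finite_Set.fold s y E = y" if "finite E" "E \<subseteq> D - B" for E y
    using that assms(4) by (induction E) (auto simp: fold_insert_family[OF assms(1)])
  then have "Finite_Set.fold s x (B \<union> (D - B)) = Finite_Set.fold s x B"
    using assms(2,3) finite_subset[OF assms(3,2)]
    by (subst fold_union_family) (auto simp: assms(1))
  then show ?thesis using assms(3) by (simp add: Un_absorb1)
qed

lemma rat_family_eq_fold:
  assumes F: "\<And>t. F t \<in> G" and D: "finite D" "rat_dom q \<subseteq> D" "0 \<notin> D"
  shows "rat_family F q x = Finite_Set.fold (\<lambda>t. F t ^^ rat_digit q t) x D"
proof -
  define f where "f = (\<lambda>t. F t ^^ rat_digit q t)"
  have fG: "f t \<in> G" for t by (simp add: f_def funpow_mem F)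
  define ts where "ts = sorted_list_of_set (rat_dom q)"
  have ts: "set ts = rat_dom q" "distinct ts"
    using finite_subset[OF D(2,1)] by (auto simp: ts_def)
  have "foldr (\<circ>) (map f xs) id x = foldr f xs x" for xs by (induction xs) auto
  then have "rat_family F q x = foldr f ts x"
    by (simp add: rat_family_def ts_def f_def)
  \<comment> \<open>Commutation makes the order of composition prescribed by
    \<open>rat_family\<close> immaterial.\<close>
  also have "\<dots> = List.fold f ts x"
    using commute[OF fG fG] by (subst foldr_fold) auto
  also have "\<dots> = Finite_Set.fold f x (rat_dom q)"
    using comp_fun_commute_on.fold_set_fold_remdups[OF comp_fun_commute_on_family[OF fG], of ts] ts
    by (simp add: distinct_remdups_id)
  also have "\<dots> = Finite_Set.fold f x D"
    using D by (intro fold_superset[symmetric] fG) (auto simp: f_def rat_dom_def)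
  finally show ?thesis by (simp add: f_def)
qed

text \<open>The factors at \<open>- n\<close> and \<open>n\<close> are grouped;
  \<open>n \<noteq> 0\<close> keeps the two indices distinct.\<close>

lemma fold_symmetric_set:
  assumes s: "\<And>t. s t \<in> G" and V: "finite V" "0 \<notin> V"
  shows "Finite_Set.fold s x (int ` V \<union> (\<lambda>n. - int n) ` V) =
           Finite_Set.fold (\<lambda>n. s (- int n) \<circ> s (int n)) x V"
  using V
proof (induction V)
  case (insert n V)
  let ?D = "int ` V \<union> (\<lambda>n. - int n) ` V"
  have ss: "s (- int n) \<circ> s (int n) \<in> G" for n using s comp_mem by blast
  have n: "int n \<notin> ?D" "- int n \<notin> insert (int n) ?D" using insert by auto
  have "int ` insert n V \<union> (\<lambda>n. - int n) ` insert n V = insert (- int n) (insert (int n) ?D)"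
    by auto
  then show ?case
    using insert n fold_insert_family[of "\<lambda>n. s (- int n) \<circ> s (int n)" V n x, OF ss]
    by (simp add: fold_insert_family s o_def)
qed simp

lemma rat_family_blocks:
  assumes F: "\<And>t. F t \<in> G"
    and V: "finite V" "0 \<notin> V" "\<And>n. n \<in> V \<Longrightarrow> p \<le> n" "\<And>n. n \<in> V \<Longrightarrow> q \<le> n"
  shows "rat_family F (of_nat p * neg_block V + of_nat q * pos_block V) x =
           Finite_Set.fold (\<lambda>n. (F (- int n) ^^ p) \<circ> (F (int n) ^^ q)) x V"
proof -
  let ?r = "of_nat p * neg_block V + of_nat q * pos_block V"
  let ?D = "int ` V \<union> (\<lambda>n. - int n) ` V"
  let ?s = "\<lambda>t. F t ^^ rat_digit ?r t"
  have sG: "?s t \<in> G" for t by (simp add: funpow_mem F)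
  have digit: "rat_digit ?r = (\<lambda>t. if nat \<bar>t\<bar> \<in> V then if t < 0 then p else q else 0)"
    by (rule rat_digit_blocks) (fact V)+
  have "t \<in> ?D" if "nat \<bar>t\<bar> \<in> V" for t
  proof -
    have "t = int (nat \<bar>t\<bar>) \<or> t = - int (nat \<bar>t\<bar>)" by linarith
    then show ?thesis using that by blast
  qed
  moreover have "nat \<bar>t\<bar> \<in> V" if "t \<in> rat_dom ?r" for t
    using that unfolding rat_dom_def digit by (simp split: if_splits)
  \<comment> \<open>In general only an inclusion: for \<open>p = 0\<close> or \<open>q = 0\<close>
    the domain misses one half of \<open>?D\<close>.\<close>
  ultimately have "rat_dom ?r \<subseteq> ?D" by blast
  then have "rat_family F ?r x = Finite_Set.fold ?s x ?D"
    using V by (intro rat_family_eq_fold F) auto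
  also have "\<dots> = Finite_Set.fold (\<lambda>n. ?s (- int n) \<circ> ?s (int n)) x V"
    using V by (intro fold_symmetric_set sG) auto
  also have "\<dots> = Finite_Set.fold (\<lambda>n. (F (- int n) ^^ p) \<circ> (F (int n) ^^ q)) x V"
  proof (rule Finite_Set.fold_cong)
    fix n assume "n \<in> V"
    moreover from this V(2) have "0 < n" by (cases n) auto
    ultimately show "?s (- int n) \<circ> ?s (int n) = (F (- int n) ^^ p) \<circ> (F (int n) ^^ q)"
      by (simp add: digit)
  qed (auto intro!: comp_fun_commute_on_family comp_mem funpow_mem F V(1))
  finally show ?thesis .
qed

end

subsection \<open>The abelian group of a rational dynamical system\<close>

context minimal_rational_dynamical_system
begin

text \<open>Extending the maps by the identity makes them commuting bijections of the whole type.\<close>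

definition ext_map :: "nat \<Rightarrow> int \<Rightarrow> 'a \<Rightarrow> 'a" where
  "ext_map i n x = (if x \<in> X \<and> n \<noteq> 0 then T i n x else x)"

text \<open>Bijections of the whole type that restrict to homeomorphisms of \<open>X\<close> onto
  itself; \<open>inv\<close> also inverts the restriction.\<close>

definition homeos :: "('a \<Rightarrow> 'a) set" where
  "homeos = {g. bij g \<and> g ` X = X \<and> continuous_on X g \<and> continuous_on X (inv g)}"

text \<open>
  The homeomorphisms in the double centralizer of the generators: an abelian group, closed under
  inverses, that contains the generators.
\<close>

definition acting_group :: "('a \<Rightarrow> 'a) set" where
  "acting_group = {g \<in> homeos. \<forall>h. (\<forall>i\<in>{1..s}. \<forall>n. h \<circ> ext_map i n = ext_map i n \<circ> h) \<longrightarrow> g \<circ> h = h \<circ> g}"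

lemma T_mem: "i \<in> {1..s} \<Longrightarrow> n \<noteq> 0 \<Longrightarrow> x \<in> X \<Longrightarrow> T i n x \<in> X"
  using homeo[of i n] by (auto simp: homeomorphism_def)

lemma ext_map_homeos:
  assumes "i \<in> {1..s}"
  shows "ext_map i n \<in> homeos"
proof (cases "n = 0")
  \<comment> \<open>By the default value at index 0 every integer \<open>n\<close> gives a
    homeomorphism, so all indices can be treated alike.\<close>
  case True
  then have "ext_map i n = id" by (auto simp: ext_map_def)
  then show ?thesis by (simp add: homeos_def id_def[symmetric] inv_id)
next
  case False
  with homeo assms obtain g where g: "homeomorphism X X (T i n) g" by blast
  define g' where "g' x = (if x \<in> X then g x else x)" for x
  have inverse: "ext_map i n \<circ> g' = id" "g' \<circ> ext_map i n = id"
    using g False by (auto simp: ext_map_def g'_def homeomorphism_def fun_eq_iff)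
  have on_X: "ext_map i n x = T i n x" "g' x = g x" if "x \<in> X" for x
    using that False by (auto simp: ext_map_def g'_def)
  have "continuous_on X (ext_map i n)" "continuous_on X g'" "ext_map i n ` X = X"
    using g by (auto simp: homeomorphism_def on_X cong: continuous_on_cong)
  moreover have "inv (ext_map i n) = g'" using inverse by (rule inv_unique_comp)
  ultimately show ?thesis using o_bij[OF inverse(2,1)] by (simp add: homeos_def)
qed

lemma ext_map_mem_acting_group:
  assumes "i \<in> {1..s}"
  shows "ext_map i n \<in> acting_group"
  using ext_map_homeos[OF assms] assms by (auto simp: acting_group_def)

lemma ext_map_commute:
  assumes "i \<in> {1..s}" "j \<in> {1..s}"
  shows "ext_map i m \<circ> ext_map j n = ext_map j n \<circ> ext_map i m"
  using assms commute[of i j m n] T_mem by (auto simp: ext_map_def fun_eq_iff)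

lemma id_mem_acting_group: "id \<in> acting_group"
  by (auto simp: acting_group_def homeos_def inv_id)

lemma inv_mem_homeos:
  assumes "g \<in> homeos"
  shows "inv g \<in> homeos"
  using assms image_inv_f_f[of g X] by (auto simp: homeos_def bij_is_inj bij_imp_bij_inv inv_inv_eq)

lemma comp_mem_homeos:
  assumes "g \<in> homeos" "h \<in> homeos"
  shows "g \<circ> h \<in> homeos"
  using assms inv_mem_homeos[OF assms(1)]
  by (simp add: homeos_def bij_comp image_comp[symmetric] o_inv_distrib continuous_on_compose
      del: o_apply)

lemma comp_mem_acting_group:
  assumes "g \<in> acting_group" "h \<in> acting_group"
  shows "g \<circ> h \<in> acting_group"
  using assms comp_mem_homeos unfolding acting_group_def by (auto simp: o_assoc) (metis o_assoc)

lemma inv_mem_acting_group: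
  assumes "g \<in> acting_group"
  shows "inv g \<in> acting_group"
proof -
  have g: "bij g" using assms by (simp add: acting_group_def homeos_def)
  have "inv g \<circ> h = h \<circ> inv g" if "g \<circ> h = h \<circ> g" for h
  proof -
    have "inv g (h (g (inv g x))) = inv g (g (h (inv g x)))" for x
      using that by (metis comp_apply)
    then show ?thesis using g by (simp add: fun_eq_iff bij_is_inj bij_is_surj surj_f_inv_f)
  qed
  then show ?thesis using assms inv_mem_homeos unfolding acting_group_def by blast
qed

text \<open>The generators commute with one another, so \<open>h\<close>, being in their double
  centralizer, commutes with each of them. Hence \<open>h\<close> lies in the centralizer, and
  \<open>g\<close> commutes with it.\<close>

lemma acting_group_commute:
  assumes "g \<in> acting_group" "h \<in> acting_group"
  shows "g \<circ> h = h \<circ> g"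
proof -
  have "h \<circ> ext_map i n = ext_map i n \<circ> h" if "i \<in> {1..s}" for i n
    using assms(2) ext_map_commute that unfolding acting_group_def by blast
  then show ?thesis using assms(1) unfolding acting_group_def by blast
qed

text \<open>The points whose orbits avoid \<open>U\<close> form a closed invariant set, empty by
  minimality. So the preimages of \<open>U\<close> cover \<open>X\<close>, and compactness leaves
  finitely many.\<close>

lemma acting_group_syndetic:
  assumes U: "openin (top_of_set X) U" "U \<noteq> {}"
  shows "\<exists>C\<subseteq>acting_group. finite C \<and> (\<forall>x\<in>X. \<exists>g\<in>C. g x \<in> U)"
proof -
  define Y where "Y = {x \<in> X. \<forall>g\<in>acting_group. g x \<notin> U}"
  have pre: "openin (top_of_set X) (X \<inter> g -` U)" if "g \<in> acting_group" for g
    using that continuous_openin_preimage[OF _ _ U(1), of X g]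
    by (auto simp: acting_group_def homeos_def)
  then have "openin (top_of_set X) (\<Union>g\<in>acting_group. X \<inter> g -` U)" by blast
  moreover have "Y = X - (\<Union>g\<in>acting_group. X \<inter> g -` U)" by (auto simp: Y_def)
  ultimately have "closedin (top_of_set X) Y"
    using closedin_diff[OF closedin_topspace[of "top_of_set X"]] by simp
  moreover have "T i n ` Y = Y" if "i \<in> {1..s}" "n \<noteq> 0" for i n
  proof -
    let ?e = "ext_map i n"
    have e: "?e \<in> acting_group" "inv ?e \<in> acting_group"
      using ext_map_mem_acting_group inv_mem_acting_group that(1) by blast+
    have Y: "g y \<in> Y" if "g \<in> acting_group" "y \<in> Y" for g y
    proof -
      have "g y \<in> X" using that by (auto simp: Y_def acting_group_def homeos_def)
      moreover have "h (g y) \<notin> U" if "h \<in> acting_group" for h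
        using comp_mem_acting_group[OF that \<open>g \<in> acting_group\<close>] \<open>y \<in> Y\<close>
        unfolding Y_def by (metis (mono_tags, lifting) comp_apply mem_Collect_eq)
      ultimately show ?thesis by (simp add: Y_def)
    qed
    \<comment> \<open>Equality rather than inclusion comes from invariance under the
      inverse.\<close>
    have "y \<in> ?e ` Y" if "y \<in> Y" for y
    proof
      have "bij ?e" using e(1) by (simp add: acting_group_def homeos_def)
      then show "y = ?e (inv ?e y)" by (simp add: bij_is_surj surj_f_inv_f)
    qed (rule Y[OF e(2) that])
    then have "?e ` Y = Y" using Y[OF e(1)] by blast
    moreover have "?e ` Y = T i n ` Y" using that(2) by (auto simp: ext_map_def Y_def image_iff)
    ultimately show ?thesis by simp
  qed
  ultimately have "Y = X \<or> Y = {}" by (rule minimal)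
  moreover obtain u where "u \<in> U" "u \<in> X" using U openin_imp_subset by blast
  moreover from this have "u \<notin> Y" using id_mem_acting_group by (force simp: Y_def)
  ultimately have "X \<subseteq> \<Union>((\<lambda>g. X \<inter> g -` U) ` acting_group)" by (auto simp: Y_def)
  moreover have "\<forall>W\<in>(\<lambda>g. X \<inter> g -` U) ` acting_group. openin (top_of_set X) W" using pre by blast
  ultimately obtain D where D: "D \<subseteq> (\<lambda>g. X \<inter> g -` U) ` acting_group" "finite D" "X \<subseteq> \<Union>D"
    using compact_space[unfolded compact_eq_openin_cover, THEN spec,
        of "(\<lambda>g. X \<inter> g -` U) ` acting_group"] by metis
  from finite_subset_image[OF D(2,1)] obtain C
    where C: "C \<subseteq> acting_group" "finite C" and DC: "D = (\<lambda>g. X \<inter> g -` U) ` C" by metis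
  have "\<exists>g\<in>C. g x \<in> U" if "x \<in> X" for x
    using subsetD[OF D(3) that] unfolding DC by auto
  with C show ?thesis by auto
qed

sublocale minimal_abelian_action X acting_group
proof
  fix g assume "g \<in> acting_group"
  then show "bij g" "continuous_on X g" "g ` X \<subseteq> X" by (auto simp: acting_group_def homeos_def)
qed (fact id_mem_acting_group comp_mem_acting_group inv_mem_acting_group acting_group_commute
      acting_group_syndetic)+

lemma rat_family_ext_map:
  assumes "i \<in> {1..s}" "x \<in> X"
  shows "rat_family (T i) q x = rat_family (ext_map i) q x"
  using assms T_mem by (intro rat_family_cong[where X = X]) (auto simp: ext_map_def)

end

section \<open>Recurrence along the rationals given by a block\<close>

theorem theorem3p2:
  fixes X U :: "'a::metric_space set"
    and T :: "nat \<Rightarrow> int \<Rightarrow> 'a \<Rightarrow> 'a"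
    and R :: "int \<Rightarrow> 'a \<Rightarrow> 'a"
    and l k :: nat
    and k1 k2 :: real
  assumes "l \<ge> 1"
    and "minimal_rational_dynamical_system X (l + 1) (T(l + 1 := R))"
    and "k \<ge> 1"
    and "k1 < k2"
    and "openin (top_of_set X) U"
    and "U \<noteq> {}"
  shows "\<exists>\<beta> \<gamma> :: rat.
           \<beta> \<notin> \<int> \<and> \<gamma> \<in> \<int> \<and> \<gamma> \<noteq> 0 \<and>
           rat_dom_pos \<beta> = {} \<and> rat_dom_neg \<gamma> = {} \<and>
           of_int (Max (rat_dom_neg \<beta>)) < k1 \<and> k2 < of_int (Min (rat_dom_pos \<gamma>)) \<and>
           (\<Inter>p\<in>{0..k}. \<Inter>q\<in>{0..k}.
              U \<inter> (\<Inter>i\<in>{1..l}. {x \<in> X. rat_family (T i) (of_nat p * \<beta> + of_nat q * \<gamma>) x \<in> U})) \<noteq> {}"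
proof -
  interpret minimal_rational_dynamical_system X "l + 1" "T(l + 1 := R)" by fact
  \<comment> \<open>The summand \<open>k\<close> prevents carries, 1 excludes the index 0 and makes
    the bounds strict, and the ceilings push the block beyond \<open>k1\<close> and
    \<open>k2\<close>.\<close>
  define N where "N = k + 1 + nat \<lceil>\<bar>k1\<bar>\<rceil> + nat \<lceil>\<bar>k2\<bar>\<rceil>"
  define S where "S = (\<lambda>(i, p, q) n. (ext_map i (- int n) ^^ p) \<circ> (ext_map i (int n) ^^ q))"
  \<comment> \<open>Indexing by triples yields one block and one point for all \<open>i\<close>,
    \<open>p\<close> and \<open>q\<close> at once.\<close>
  define A where "A = {1..l} \<times> {0..k} \<times> {0..k}"
  have "S a n \<in> acting_group" if "a \<in> A" for a n
  proof -
    obtain i p q where a: "a = (i, p, q)" "i \<in> {1..l}" using \<open>a \<in> A\<close> unfolding A_def by blast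
    then have "i \<in> {1..l + 1}" by simp
    with a(1) show ?thesis by (simp only: S_def prod.case comp_mem funpow_mem ext_map_mem_acting_group)
  qed
  moreover have "finite A" by (simp add: A_def)
  ultimately obtain V :: "nat set" and x where V: "finite V" "V \<noteq> {}" "V \<subseteq> {N..}"
    and x: "x \<in> U" "\<And>a. a \<in> A \<Longrightarrow> Finite_Set.fold (S a) x V \<in> U"
    using ip_recurrence[of A S U N] assms(5,6) by metis
  have V0: "0 \<notin> V" and Vk: "\<And>n. n \<in> V \<Longrightarrow> k \<le> n" using V(3) by (auto simp: N_def)
  have xX: "x \<in> X" using x(1) openin_imp_subset[OF assms(5)] by blast
  have neg: "rat_dom_neg (neg_block V) = (\<lambda>s. - int s) ` V" "rat_dom_pos (neg_block V) = {}"
    using V0 by (auto simp: rat_dom_neg_def rat_dom_pos_def rat_dom_neg_block[OF V(1) V0] intro: gr0I)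
  have pos: "rat_dom_pos (pos_block V) = int ` V" "rat_dom_neg (pos_block V) = {}"
    using V0 by (auto simp: rat_dom_neg_def rat_dom_pos_def rat_dom_pos_block[OF V(1) V0] intro: gr0I)
  \<comment> \<open>Since \<open>V\<close> is non-empty, the maximum is attained and inherits the
    bound from \<open>V \<subseteq> {N..}\<close>.\<close>
  have "Max (rat_dom_neg (neg_block V)) \<in> rat_dom_neg (neg_block V)"
    using V by (intro Max_in) (auto simp: neg)
  then have "of_int (Max (rat_dom_neg (neg_block V))) \<le> - real N" using V(3) by (auto simp: neg)
  moreover have "- real N < k1" unfolding N_def by linarith
  ultimately have k1: "of_int (Max (rat_dom_neg (neg_block V))) < k1" by linarith
  have "Min (rat_dom_pos (pos_block V)) \<in> rat_dom_pos (pos_block V)"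
    using V by (intro Min_in) (auto simp: pos)
  then have "real N \<le> of_int (Min (rat_dom_pos (pos_block V)))" using V(3) by (auto simp: pos)
  moreover have "k2 < real N" unfolding N_def by linarith
  ultimately have k2: "k2 < of_int (Min (rat_dom_pos (pos_block V)))" by linarith
  have nz: "pos_block V \<noteq> 0"
  proof
    \<comment> \<open>0 is the value of the empty block, and the domain determines the
      block.\<close>
    assume "pos_block V = 0"
    then have "rat_dom (pos_block V) = rat_dom (pos_block {})" by (simp add: pos_block_def)
    then show False using V(2) by (simp add: rat_dom_pos_block V(1) V0)
  qed
  have fam: "rat_family (T i) (of_nat p * neg_block V + of_nat q * pos_block V) x \<in> U"
    if "i \<in> {1..l}" "p \<le> k" "q \<le> k" for i p q
  proof -
    \<comment> \<open>As \<open>i \<le> l\<close>, putting \<open>R\<close> at \<open>l + 1\<close>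
      leaves \<open>T i\<close> unchanged.\<close>
    have i: "i \<in> {1..l + 1}" "T i = (T(l + 1 := R)) i" using that(1) by auto
    have "rat_family (T i) (of_nat p * neg_block V + of_nat q * pos_block V) x =
          Finite_Set.fold (S (i, p, q)) x V"
      unfolding i(2) rat_family_ext_map[OF i(1) xX]
      using that Vk by (subst rat_family_blocks[OF ext_map_mem_acting_group[OF i(1)] V(1) V0])
        (force simp: S_def intro: order_trans)+
    then show ?thesis using x(2)[of "(i, p, q)"] that by (simp add: A_def)
  qed
  show ?thesis
  proof (rule exI[of _ "neg_block V"], rule exI[of _ "pos_block V"], intro conjI)
    have "x \<in> (\<Inter>p\<in>{0..k}. \<Inter>q\<in>{0..k}. U \<inter> (\<Inter>i\<in>{1..l}.
        {x \<in> X. rat_family (T i) (of_nat p * neg_block V + of_nat q * pos_block V) x \<in> U}))"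
      using x(1) xX by (intro INT_I IntI CollectI conjI fam) simp_all
    then show "(\<Inter>p\<in>{0..k}. \<Inter>q\<in>{0..k}. U \<inter> (\<Inter>i\<in>{1..l}.
        {x \<in> X. rat_family (T i) (of_nat p * neg_block V + of_nat q * pos_block V) x \<in> U})) \<noteq> {}"
      by blast
  qed (fact neg_block_notin_Ints[OF V(1,2) V0] pos_block_in_Ints nz neg(2) pos(2) k1 k2)+
qed

end
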